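(* Assume that at time $k$ the belief density of every agent $i=1,\dots,n$ has the exponential form $$d\mu_k^i(M)=f(\chi^i_k,\nu^i_k)\exp\big(M'\chi^i_k-\nu^i_kC(M)\big)$$ with parameters $\chi_k^i\in\mathbb{R}^s$ and $\nu_k^i>0$, and that these densities are conjugate priors of the agents' likelihood models $p^i_M(x)=H^i(x)\exp(M'T^i(x)-C(M))$. Then the belief density of agent $i$ at time $k+1$ computed by the update rule $$d\mu_{k+1}^i(M)\ \propto\ p^i_M(x^i_{k+1})\prod_{j=1}^n\big(d\mu_k^j(M)\big)^{a_{ij}}$$ has the same form as the beliefs at time $k$, with parameters $$\chi^i_{k+1}=\sum_{j=1}^na_{ij}\chi^j_k+T^i(x^i_{k+1}),\qquad\nu^i_{k+1}=\sum_{j=1}^na_{ij}\nu^j_k+1\qquad\text{for all }i=1,\dots,n.$$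
   Context: There are $n$ agents; agent $i$ receives the observation $x^i_{k+1}$ at time $k+1$. Likelihoods are members of the exponential family in canonical form: $p^i_M(x)=H^i(x)\exp(M'T^i(x)-C(M))$, where $M\in\mathbb{R}^s$ is the natural parameter, $T^i$ the sufficient statistic and $M'$ the transpose. The conjugate prior is a probability density over $M$ of the form $p_{\chi,\nu}(M)=f(\chi,\nu)\exp(M'\chi-\nu C(M))$, with $\chi\in\mathbb{R}^s$, $\nu>0$ and $f(\chi,\nu)$ the normalizing constant. "Conjugate prior" means that the posterior proportional to likelihood times prior is in the same family as the prior. The weights $a_{ij}\ge0$ are the entries of a stochastic matrix ($\sum_ja_{ij}=1$). "$\propto$" means normalization to a probability density in $M$ (assumed possible). *)

theory Defs
  imports "HOL-Analysis.Analysis"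
begin

definition prob_density :: "'a measure \<Rightarrow> ('a \<Rightarrow> real) \<Rightarrow> bool" where
  "prob_density S p \<longleftrightarrow>
     p \<in> borel_measurable S \<and> (\<forall>x\<in>space S. 0 \<le> p x) \<and> (\<integral>\<^sup>+ x. ennreal (p x) \<partial>S) = 1"

text \<open>The relation \<open>p \<propto> g\<close>: \<open>p\<close> is the probability density on \<open>\<real>\<^sup>s\<close>
  obtained by normalizing \<open>g\<close>. It can hold only if \<open>g\<close> is normalizable.\<close>

definition normalized_from :: "(real ^ 's \<Rightarrow> real) \<Rightarrow> (real ^ 's \<Rightarrow> real) \<Rightarrow> bool" where
  "normalized_from p g \<longleftrightarrow> prob_density lborel p \<and> (\<exists>c>0. \<forall>M. p M = c * g M)"

definition stochastic_matrix :: "real ^ 'n ^ 'n \<Rightarrow> bool" where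
  "stochastic_matrix A \<longleftrightarrow> (\<forall>i j. 0 \<le> A $ i $ j) \<and> (\<forall>i. (\<Sum>j\<in>UNIV. A $ i $ j) = 1)"

definition exp_likelihood ::
  "('x \<Rightarrow> real) \<Rightarrow> ('x \<Rightarrow> real ^ 's) \<Rightarrow> (real ^ 's \<Rightarrow> real) \<Rightarrow> real ^ 's \<Rightarrow> 'x \<Rightarrow> real" where
  "exp_likelihood H T C M x = H x * exp (M \<bullet> T x - C M)"

text \<open>Here \<open>S\<close> is the reference measure on the observation space, for example Lebesgue or
  counting measure.\<close>

definition exponential_family ::
  "'x measure \<Rightarrow> ('x \<Rightarrow> real) \<Rightarrow> ('x \<Rightarrow> real ^ 's) \<Rightarrow> (real ^ 's \<Rightarrow> real) \<Rightarrow> bool" where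
  "exponential_family S H T C \<longleftrightarrow>
     H \<in> borel_measurable S \<and> (\<forall>x\<in>space S. 0 \<le> H x) \<and> T \<in> borel_measurable S \<and>
     (\<forall>M. prob_density S (exp_likelihood H T C M))"

text \<open>If the integral diverges, the Bochner integral and hence \<open>normalizer\<close> is \<open>0\<close>; the density
  condition in \<open>has_conj_form\<close> excludes such parameters.\<close>

definition normalizer :: "(real ^ 's \<Rightarrow> real) \<Rightarrow> real ^ 's \<Rightarrow> real \<Rightarrow> real" where
  "normalizer C chi \<nu> = 1 / (\<integral>M. exp (M \<bullet> chi - \<nu> * C M) \<partial>lborel)"

definition has_conj_form ::
  "(real ^ 's \<Rightarrow> real) \<Rightarrow> real ^ 's \<Rightarrow> real \<Rightarrow> (real ^ 's \<Rightarrow> real) \<Rightarrow> bool" where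
  "has_conj_form C chi \<nu> p \<longleftrightarrow>
     0 < \<nu> \<and> prob_density lborel p \<and>
     (\<forall>M. p M = normalizer C chi \<nu> * exp (M \<bullet> chi - \<nu> * C M))"

definition conj_family :: "(real ^ 's \<Rightarrow> real) \<Rightarrow> (real ^ 's \<Rightarrow> real) set" where
  "conj_family C = {p. \<exists>chi \<nu>. has_conj_form C chi \<nu> p}"

definition conjugate_prior_family ::
  "(real ^ 's \<Rightarrow> real) set \<Rightarrow> 'x set \<Rightarrow> (real ^ 's \<Rightarrow> 'x \<Rightarrow> real) \<Rightarrow> bool" where
  "conjugate_prior_family F X L \<longleftrightarrow>
     (\<forall>p\<in>F. \<forall>x\<in>X. \<forall>q. normalized_from q (\<lambda>M. L M x * p M) \<longrightarrow> q \<in> F)"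

text \<open>Beware that \<open>0 powr 0 = 0\<close>; this is harmless for the beliefs considered here, since densities
  satisfying \<open>has_conj_form\<close> are positive everywhere.\<close>

definition belief_update ::
  "real ^ 'n ^ 'n \<Rightarrow> ('n \<Rightarrow> real ^ 's \<Rightarrow> 'x \<Rightarrow> real) \<Rightarrow> ('n \<Rightarrow> real ^ 's \<Rightarrow> real) \<Rightarrow>
     ('n \<Rightarrow> 'x) \<Rightarrow> ('n \<Rightarrow> real ^ 's \<Rightarrow> real) \<Rightarrow> bool" where
  "belief_update A L \<mu> x \<mu>' \<longleftrightarrow>
     (\<forall>i. normalized_from (\<mu>' i) (\<lambda>M. L i M (x i) * (\<Prod>j\<in>UNIV. \<mu> j M powr (A $ i $ j))))"

end

theory Submission
  imports Defs
begin

text \<open>A weighted geometric mean of functions \<open>K * exp e\<close> averages the exponents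
  linearly, so pooling beliefs averages the pairs \<open>(chi, \<nu>)\<close>
  (\<open>prod_scaled_exp_powr\<close>). Multiplying by the likelihood then adds \<open>T\<close> to
  the first parameter and 1 to the second. All remaining factors are constant in \<open>M\<close>,
  and their product need not be computed: the update yields a density, and total mass 1 forces the
  constant to be the normalizer (\<open>has_conj_formI\<close>).\<close>

lemma prob_density_scale_pos:
  assumes dens: "prob_density S p"
    and p: "\<And>M. p M = K * g M" and g: "\<And>M. 0 < g M"
  shows "(0::real) < K"
proof -
  \<comment> \<open>The zero function cannot have integral 1.\<close>
  have "K \<noteq> 0"
    using dens by (auto simp: prob_density_def p)
  moreover obtain M where "M \<in> space S"
  proof -
    have "space S \<noteq> {}"
      using dens nn_integral_empty[of S] by (auto simp: prob_density_def)
    then show thesis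
      using that by blast
  qed
  then have "0 \<le> K * g M"
    using dens p by (auto simp: prob_density_def)
  then have "0 \<le> K"
    using g[of M] by (simp add: zero_le_mult_iff)
  ultimately show ?thesis
    by simp
qed

text \<open>Integrating \<open>p\<close> gives \<open>K\<close> times the integral of the
  exponential, and this must be 1, so \<open>K\<close> is determined.\<close>

lemma has_conj_formI:
  assumes "0 < \<nu>" and dens: "prob_density lborel p"
    and p: "\<And>M. p M = K * exp (M \<bullet> chi - \<nu> * C M)"
  shows "has_conj_form C chi \<nu> p"
proof -
  have "(\<integral>M. p M \<partial>lborel) = 1"
    using dens by (subst integral_eq_nn_integral) (auto simp: prob_density_def)
  then have "K * (\<integral>M. exp (M \<bullet> chi - \<nu> * C M) \<partial>lborel) = 1"
    by (simp add: p)
  \<comment> \<open>The product being 1 rules out the value 0 that a divergent Bochner integral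
    would take, so the division is legitimate.\<close>
  then have "normalizer C chi \<nu> = K"
    unfolding normalizer_def by (metis mult_zero_right nonzero_eq_divide_eq zero_neq_one)
  with assms show ?thesis
    by (simp add: has_conj_form_def)
qed

text \<open>Supplies the positive constants under which \<open>powr\<close> is split in
  \<open>prod_scaled_exp_powr\<close>.\<close>

lemma has_conj_form_normalizer_pos:
  assumes "has_conj_form C chi \<nu> p"
  shows "0 < normalizer C chi \<nu>"
proof (rule prob_density_scale_pos)
  show "prob_density lborel p"
    using assms by (simp add: has_conj_form_def)
  show "p M = normalizer C chi \<nu> * exp (M \<bullet> chi - \<nu> * C M)" for M
    using assms by (simp add: has_conj_form_def)
qed simp

text \<open>A real power distributes over positive factors and scales the exponent of
  \<open>exp\<close>; the product over \<open>I\<close> then turns these exponents into a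
  sum.\<close>

lemma prod_scaled_exp_powr:
  fixes c e a :: "'i \<Rightarrow> real"
  assumes "finite I" and "\<And>j. j \<in> I \<Longrightarrow> 0 < c j"
  shows "(\<Prod>j\<in>I. (c j * exp (e j)) powr a j) = (\<Prod>j\<in>I. c j powr a j) * exp (\<Sum>j\<in>I. a j * e j)"
proof -
  have "(c j * exp (e j)) powr a j = c j powr a j * exp (a j * e j)" if "j \<in> I" for j
    using assms(2)[OF that] by (simp add: powr_mult exp_powr_real mult.commute)
  then show ?thesis
    by (simp add: prod.distrib exp_sum[OF assms(1)])
qed

lemma stochastic_matrix_average_nonneg:
  assumes "stochastic_matrix A" and "\<And>j. 0 \<le> \<nu> j"
  shows "0 \<le> (\<Sum>j\<in>UNIV. A $ i $ j * \<nu> j)"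
  using assms by (auto simp: stochastic_matrix_def intro!: sum_nonneg)

theorem proposition3:
  fixes S :: "'n::finite \<Rightarrow> 'x measure"
    and H :: "'n \<Rightarrow> 'x \<Rightarrow> real"
    and T :: "'n \<Rightarrow> 'x \<Rightarrow> real ^ 's"
    and C :: "real ^ 's \<Rightarrow> real"
    and A :: "real ^ 'n ^ 'n"
    and x :: "nat \<Rightarrow> 'n \<Rightarrow> 'x"
    and \<mu> :: "nat \<Rightarrow> 'n \<Rightarrow> real ^ 's \<Rightarrow> real"
    and k :: nat
    and chi :: "'n \<Rightarrow> real ^ 's"
    and \<nu> :: "'n \<Rightarrow> real"
  assumes "stochastic_matrix A"
    and "\<And>i. exponential_family (S i) (H i) (T i) C"
    and "\<And>i. x (Suc k) i \<in> space (S i)"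
    and "\<And>i. has_conj_form C (chi i) (\<nu> i) (\<mu> k i)"
    and "\<And>i. conjugate_prior_family (conj_family C) (space (S i)) (exp_likelihood (H i) (T i) C)"
    and "belief_update A (\<lambda>i. exp_likelihood (H i) (T i) C) (\<mu> k) (x (Suc k)) (\<mu> (Suc k))"
  shows "\<forall>i. has_conj_form C
               ((\<Sum>j\<in>UNIV. (A $ i $ j) *\<^sub>R chi j) + T i (x (Suc k) i))
               ((\<Sum>j\<in>UNIV. A $ i $ j * \<nu> j) + 1)
               (\<mu> (Suc k) i)"
proof
  fix i
  let ?n = "\<lambda>j. normalizer C (chi j) (\<nu> j)"
  let ?e = "\<lambda>M j. M \<bullet> chi j - \<nu> j * C M"
  obtain c where dens: "prob_density lborel (\<mu> (Suc k) i)"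
    and c: "\<And>M. \<mu> (Suc k) i M = c * (exp_likelihood (H i) (T i) C M (x (Suc k) i)
              * (\<Prod>j\<in>UNIV. \<mu> k j M powr (A $ i $ j)))"
    using assms(6) unfolding belief_update_def normalized_from_def by blast
  have \<nu>: "0 < \<nu> j" and \<mu>: "\<mu> k j M = ?n j * exp (?e M j)" for j M
    using assms(4)[of j] by (auto simp: has_conj_form_def)
  \<comment> \<open>The weighted sum is nonnegative because the weights are; the 1 from the
    likelihood makes the inequality strict.\<close>
  have "0 < (\<Sum>j\<in>UNIV. A $ i $ j * \<nu> j) + 1"
    using stochastic_matrix_average_nonneg[OF assms(1), of \<nu> i] \<nu>
    by (simp add: less_imp_le add_nonneg_pos)
  \<comment> \<open>Everything in front of \<open>exp\<close> is independent of \<open>M\<close> and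
    serves as the constant \<open>K\<close> of \<open>has_conj_formI\<close>.\<close>
  moreover have "\<mu> (Suc k) i M = c * H i (x (Suc k) i) * (\<Prod>j\<in>UNIV. ?n j powr (A $ i $ j))
      * exp (M \<bullet> ((\<Sum>j\<in>UNIV. (A $ i $ j) *\<^sub>R chi j) + T i (x (Suc k) i))
             - ((\<Sum>j\<in>UNIV. A $ i $ j * \<nu> j) + 1) * C M)" for M
  proof -
    let ?P = "\<Prod>j\<in>UNIV. ?n j powr (A $ i $ j)"
    let ?E = "\<Sum>j\<in>UNIV. A $ i $ j * ?e M j"
    have "(\<Prod>j\<in>UNIV. \<mu> k j M powr (A $ i $ j)) = ?P * exp ?E"
      unfolding \<mu> using has_conj_form_normalizer_pos[OF assms(4)]
      by (intro prod_scaled_exp_powr) auto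
    then have "\<mu> (Suc k) i M = c * H i (x (Suc k) i) * ?P * exp (M \<bullet> T i (x (Suc k) i) - C M + ?E)"
      unfolding c exp_likelihood_def exp_add by (simp only: mult_ac)
    \<comment> \<open>The exponent is linear in \<open>(chi, \<nu>)\<close>; the term
      \<open>- C M\<close> of the likelihood accounts for the 1 added to the second
      parameter.\<close>
    also have "M \<bullet> T i (x (Suc k) i) - C M + ?E
        = M \<bullet> ((\<Sum>j\<in>UNIV. (A $ i $ j) *\<^sub>R chi j) + T i (x (Suc k) i))
          - ((\<Sum>j\<in>UNIV. A $ i $ j * \<nu> j) + 1) * C M"
      by (simp add: inner_add_right inner_sum_right right_diff_distrib sum_subtractf
          sum_distrib_right distrib_right mult.assoc)
    finally show ?thesis .
  qed
  ultimately show "has_conj_form C ((\<Sum>j\<in>UNIV. (A $ i $ j) *\<^sub>R chi j) + T i (x (Suc k) i))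
      ((\<Sum>j\<in>UNIV. A $ i $ j * \<nu> j) + 1) (\<mu> (Suc k) i)"
    by (rule has_conj_formI[OF _ dens])
qed

end
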